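(* There is an absolute constant $C>0$ such that for all positive integers $n$ and $t\ge2$ and all $\pi,\tau\in S_n$ with $d(\pi,\tau)=t$, \[\Delta(\lambda(\pi),\lambda(\tau))\le C\sqrt{n\,t\ln t}.\]
   Context: Permutations are written in one-line notation. For $\pi\in S_n$, $\lambda(\pi)$ denotes the shape of the tableaux associated with $\pi$ by the RSK correspondence. The distance $d(\pi,\tau)$ is the least number of adjacent transpositions $(k,k+1)$, $1\le k\le n-1$, whose successive left multiplication transforms $\pi$ into $\tau$. For partitions $\lambda,\mu$ of $n$ (parts padded with zeros), $\Delta(\lambda,\mu)=\frac12\sum_{i=1}^n|\lambda_i-\mu_i|$. *)

theory Defs
  imports Complex_Main
begin

text \<open>Permutations of {1..n} in one-line notation, as lists.\<close>
definition is_perm :: "nat \<Rightarrow> nat list \<Rightarrow> bool" where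
  "is_perm n p \<longleftrightarrow> distinct p \<and> set p = {1..n}"

text \<open>Left multiplication by the adjacent transposition (k,k+1): swap the values k and k+1.\<close>
definition adj_swap :: "nat \<Rightarrow> nat list \<Rightarrow> nat list" where
  "adj_swap k p = map (\<lambda>x. if x = k then k + 1 else if x = k + 1 then k else x) p"

definition perm_dist :: "nat \<Rightarrow> nat list \<Rightarrow> nat list \<Rightarrow> nat" where
  "perm_dist n p q = (LEAST m. \<exists>ks. length ks = m \<and> (\<forall>k\<in>set ks. 1 \<le> k \<and> k \<le> n - 1)
                                   \<and> fold adj_swap ks p = q)"

fun row_insert :: "nat list list \<Rightarrow> nat \<Rightarrow> nat list list" where
  "row_insert [] x = [[x]]"
| "row_insert (r # rs) x =
     (if \<forall>y\<in>set r. y < x then (r @ [x]) # rs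
      else (takeWhile (\<lambda>z. z < x) r @ [x] @ tl (dropWhile (\<lambda>z. z < x) r))
           # row_insert rs (hd (dropWhile (\<lambda>z. z < x) r)))"

definition rsk_P :: "nat list \<Rightarrow> nat list list" where
  "rsk_P p = foldl row_insert [] p"

definition rsk_shape :: "nat list \<Rightarrow> nat list" where
  "rsk_shape p = map length (rsk_P p)"

definition part_entry :: "nat list \<Rightarrow> nat \<Rightarrow> nat" where
  "part_entry la i = (if i < length la then la ! i else 0)"

definition part_dist :: "nat \<Rightarrow> nat list \<Rightarrow> nat list \<Rightarrow> real" where
  "part_dist n la mu = (1/2) * (\<Sum>i<n. \<bar>real (part_entry la i) - real (part_entry mu i)\<bar>)"

end

(* By Greene's theorem, lambda_1 + ... + lambda_j is the largest length of a subsequence without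
   decreasing subsequences longer than j. Swapping the values k and k + 1 changes this number by at
   most one, because deleting k makes the swap order preserving. So all partial row sums of the two
   shapes differ by at most t, and it remains to show that two partitions of n with this property
   satisfy the bound. Where lambda_i - mu_i changes sign after reaching h over L rows, the shapes
   must drop by h, while the run costs at most min (2 t) (h L) <= sqrt (2 t h L). Weighting by the row
   index (Cauchy-Schwarz, in the linear form alpha h + beta L) the drops are controlled by the area n
   and the lengths by a harmonic sum; only rows between sqrt (n / t) and sqrt (n t) need this
   argument, which gives the factor ln t. *)

theory Submission
  imports Defs "HOL-Library.Sublist" "HOL-Combinatorics.Permutations"
begin

section \<open>Partitions with close partial sums\<close>

text \<open>One pair of weights \<alpha>, \<beta> for all rows cannot work: \<alpha> multiplies the
  total drop, the first row alone may have length n, and optimising \<alpha> against \<beta> over n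
  rows then gives only order n * sqrt t. Hence the weights change from one dyadic block of rows to
  the next. The price is one unfinished run per block, which has no drop to be charged to and costs
  up to 2 t. About log t blocks lose t * ln t in this way; that is within the bound exactly when t *
  ln t is at most n, up to constants, and in the opposite case the trivial estimate 2 n already
  suffices.\<close>

lemma run_bound:
  fixes l m :: "nat \<Rightarrow> nat" and a c :: nat and T \<alpha> \<beta> :: real
  assumes l: "antimono l" and m: "antimono m" and ac: "a < c"
    and pos: "\<And>i. i \<in> {a..<c} \<Longrightarrow> m i < l i" and cross: "l c \<le> m c"
    and sum: "(\<Sum>i=a..<c. real (l i) - real (m i)) \<le> T"
    and ab: "\<And>h L :: nat. 1 \<le> h \<Longrightarrow> 1 \<le> L \<Longrightarrow> min T (real h * real L) \<le> \<alpha> * real h + \<beta> * real L"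
    and \<alpha>: "0 \<le> \<alpha>"
  shows "(\<Sum>i=a..<c. real (l i) - real (m i)) \<le> \<alpha> * (real (l a) - real (l c)) + \<beta> * (real c - real a)"
proof -
  define h where "h = Max ((\<lambda>i. l i - m i) ` {a..<c})"
  have "h \<in> (\<lambda>i. l i - m i) ` {a..<c}"
    unfolding h_def using ac by (intro Max_in) auto
  then obtain i where i: "i \<in> {a..<c}" "h = l i - m i" by auto
  have h1: "1 \<le> h" using pos[OF i(1)] i(2) by simp
  \<comment> \<open>Chain: \<open>l c \<le> m c \<le> m i = l i - h \<le> l a - h\<close>, so
    \<open>l\<close> alone falls by \<open>h\<close> across the run.\<close>
  have "l i \<le> l a" "m c \<le> m i" using i l m by (auto simp: antimono_def)
  then have drop: "real h \<le> real (l a) - real (l c)"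
    using i(2) pos[OF i(1)] cross by linarith
  have "real (l k) - real (m k) \<le> real h" if "k \<in> {a..<c}" for k
  proof -
    have "l k - m k \<le> h" unfolding h_def using that by (intro Max_ge) auto
    then show ?thesis by linarith
  qed
  then have "(\<Sum>i=a..<c. real (l i) - real (m i)) \<le> real (card {a..<c}) * real h"
    by (intro sum_bounded_above)
  then have "(\<Sum>i=a..<c. real (l i) - real (m i)) \<le> min T (real h * real (c - a))"
    using sum by (simp add: mult.commute)
  also have "\<dots> \<le> \<alpha> * real h + \<beta> * real (c - a)"
    using h1 ac by (intro ab) auto
  also have "\<dots> \<le> \<alpha> * (real (l a) - real (l c)) + \<beta> * (real c - real a)"
    using drop \<alpha> ac by (simp add: mult_left_mono of_nat_diff)
  finally show ?thesis .
qed

lemma run_split: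
  fixes l m :: "nat \<Rightarrow> nat"
  assumes "m a < l a"
  shows "(\<forall>i\<in>{a..<b}. m i < l i) \<or>
    (\<exists>c. a < c \<and> c < b \<and> (\<forall>i\<in>{a..<c}. m i < l i) \<and> l c \<le> m c)"
proof (cases "\<exists>i. a \<le> i \<and> i < b \<and> l i \<le> m i")
  case True
  then obtain c where c: "a \<le> c \<and> c < b \<and> l c \<le> m c"
    and least: "\<And>i. i < c \<Longrightarrow> \<not> (a \<le> i \<and> i < b \<and> l i \<le> m i)"
    using exists_least_iff[of "\<lambda>i. a \<le> i \<and> i < b \<and> l i \<le> m i"] by blast
  have "\<forall>i\<in>{a..<c}. m i < l i"
    using least c by (metis atLeastLessThan_iff less_trans not_le)
  moreover have "a < c" using c assms by (cases "a = c") auto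
  ultimately show ?thesis using c by blast
next
  case False
  then have "\<forall>i\<in>{a..<b}. m i < l i" by (metis atLeastLessThan_iff not_le)
  then show ?thesis ..
qed

text \<open>Split \<open>[a, b)\<close> into runs on which \<open>l - m\<close> keeps its sign. A run of length \<open>L\<close> and maximal
  deviation \<open>h\<close> contributes at most \<open>min T (h * L)\<close>, and \<open>l + m\<close> drops by at least \<open>h\<close> before the
  next run starts; only the last run, which may be cut off at \<open>b\<close>, is charged to the summand \<open>T\<close>.\<close>

lemma oscillation_bound:
  fixes l m :: "nat \<Rightarrow> nat" and T \<alpha> \<beta> :: real
  assumes l: "antimono l" and m: "antimono m"
    and T: "\<And>a b. \<bar>\<Sum>i=a..<b. real (l i) - real (m i)\<bar> \<le> T"
    and ab: "\<And>h L :: nat. 1 \<le> h \<Longrightarrow> 1 \<le> L \<Longrightarrow> min T (real h * real L) \<le> \<alpha> * real h + \<beta> * real L"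
    and \<alpha>: "0 \<le> \<alpha>" and \<beta>: "0 \<le> \<beta>" and "a \<le> b"
  shows "(\<Sum>i=a..<b. \<bar>real (l i) - real (m i)\<bar>)
    \<le> T + \<alpha> * (real (l a + m a) - real (l b + m b)) + \<beta> * (real b - real a)"
  using \<open>a \<le> b\<close>
proof (induction "b - a" arbitrary: a rule: less_induct)
  case less
  let ?e = "\<lambda>i. real (l i) - real (m i)"
  \<comment> \<open>Runs with \<open>m < l\<close> consume the drop of \<open>l\<close>, runs with
    \<open>l < m\<close> that of \<open>m\<close>; the sum serves as one budget for both
    signs.\<close>
  let ?R = "\<lambda>a b. \<alpha> * (real (l a + m a) - real (l b + m b)) + \<beta> * (real b - real a)"
  have T0: "0 \<le> T" using T[of 0 0] by simp
  have mono: "l y \<le> l x" "m y \<le> m x" if "x \<le> y" for x y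
    using antimonoD[OF l that] antimonoD[OF m that] by auto
  have R0: "0 \<le> ?R x y" if "x \<le> y" for x y
    using mono[OF that] that \<alpha> \<beta>
    by (intro add_nonneg_nonneg mult_nonneg_nonneg) auto
  have whole: ?case if "(\<Sum>i=a..<b. \<bar>?e i\<bar>) = \<bar>\<Sum>i=a..<b. ?e i\<bar>"
    using that T[of a b] R0[OF less.prems] by linarith
  have step: ?case if c: "a < c" "c \<le> b" and run: "(\<Sum>i=a..<c. \<bar>?e i\<bar>) \<le> ?R a c" for c
  proof -
    have "(\<Sum>i=a..<b. \<bar>?e i\<bar>) = (\<Sum>i=a..<c. \<bar>?e i\<bar>) + (\<Sum>i=c..<b. \<bar>?e i\<bar>)"
      using c by (simp add: sum.atLeastLessThan_concat)
    moreover have "(\<Sum>i=c..<b. \<bar>?e i\<bar>) \<le> T + \<alpha> * (real (l c + m c) - real (l b + m b)) + \<beta> * (real b - real c)"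
      using c by (intro less.hyps) auto
    ultimately show ?thesis using run by (simp add: algebra_simps)
  qed
  consider "a = b" | "a < b" "l a = m a" | "a < b" "m a < l a" | "a < b" "l a < m a"
    using less.prems by linarith
  then show ?case
  proof cases
    case 1
    then show ?thesis using T0 by simp
  next
    case 2
    then have "(\<Sum>i=a..<Suc a. \<bar>?e i\<bar>) \<le> ?R a (Suc a)"
      using R0[of a "Suc a"] by simp
    then show ?thesis using 2 by (intro step[of "Suc a"]) auto
  next
    case 3
    from run_split[of m a l b, OF 3(2)] show ?thesis
    proof (elim disjE exE conjE)
      assume "\<forall>i\<in>{a..<b}. m i < l i"
      then have "(\<Sum>i=a..<b. \<bar>?e i\<bar>) = (\<Sum>i=a..<b. ?e i)" by (intro sum.cong refl abs_of_pos) simp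
      moreover have "0 \<le> (\<Sum>i=a..<b. \<bar>?e i\<bar>)" by (intro sum_nonneg) simp
      ultimately show ?thesis by (intro whole) linarith
    next
      fix c assume c: "a < c" "c < b" "\<forall>i\<in>{a..<c}. m i < l i" "l c \<le> m c"
      have "(\<Sum>i=a..<c. \<bar>?e i\<bar>) = (\<Sum>i=a..<c. ?e i)" using c by (intro sum.cong refl abs_of_pos) simp
      also have "\<dots> \<le> \<alpha> * (real (l a) - real (l c)) + \<beta> * (real c - real a)"
        using c T[of a c] by (intro run_bound[OF l m c(1) _ c(4) _ ab \<alpha>]) auto
      also have "\<dots> \<le> ?R a c"
        using mono[of a c] c(1) \<alpha> by (intro add_right_mono mult_left_mono) auto
      finally show ?thesis using c by (intro step) auto
    qed
  next
    case 4
    have flip: "(\<Sum>i=x..<y. real (m i) - real (l i)) = - (\<Sum>i=x..<y. ?e i)" for x y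
      by (simp add: sum_subtractf)
    from run_split[of l a m b, OF 4(2)] show ?thesis
    proof (elim disjE exE conjE)
      assume "\<forall>i\<in>{a..<b}. l i < m i"
      then have "(\<Sum>i=a..<b. \<bar>?e i\<bar>) = (\<Sum>i=a..<b. real (m i) - real (l i))" by (intro sum.cong refl) (simp add: abs_if)
      moreover have "0 \<le> (\<Sum>i=a..<b. \<bar>?e i\<bar>)" by (intro sum_nonneg) simp
      ultimately show ?thesis using flip[of a b] by (intro whole) linarith
    next
      fix c assume c: "a < c" "c < b" "\<forall>i\<in>{a..<c}. l i < m i" "m c \<le> l c"
      have "(\<Sum>i=a..<c. \<bar>?e i\<bar>) = (\<Sum>i=a..<c. real (m i) - real (l i))" using c by (intro sum.cong refl) (simp add: abs_if)
      also have "\<dots> \<le> \<alpha> * (real (m a) - real (m c)) + \<beta> * (real c - real a)"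
        using c T[of a c] flip[of a c] by (intro run_bound[OF m l c(1) _ c(4) _ ab \<alpha>]) auto
      also have "\<dots> \<le> ?R a c"
        using mono[of a c] c(1) \<alpha> by (intro add_right_mono mult_left_mono) auto
      finally show ?thesis using c by (intro step) auto
    qed
  qed
qed

section \<open>Dyadic blocks of rows and the area under the shapes\<close>

text \<open>By Abel summation the left side is \<open>I * g I\<close> plus the areas
  \<open>2^k * I * g (2^Suc k * I)\<close>: disjoint rectangles that fit under the decreasing
  function \<open>g\<close>. The boundary term is kept because it later bounds \<open>g\<close> at
  the start of the tail.\<close>

lemma dyadic_area:
  fixes g :: "nat \<Rightarrow> nat"
  assumes g: "antimono g"
  shows "(\<Sum>k<K. real (2^k * I) * (real (g (2^k * I)) - real (g (2^Suc k * I))))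
      + real (2^K * I) * real (g (2^K * I)) \<le> (\<Sum>i<2^K * I. real (g i))"
proof (induction K)
  case 0
  have "real (card {..<I}) * real (g I) \<le> (\<Sum>i<I. real (g i))"
    using g by (intro sum_bounded_below) (auto simp: antimono_def)
  then show ?case by simp
next
  case (Suc K)
  let ?N = "2^K * I"
  have "real (card {?N..<2*?N}) * real (g (2*?N)) \<le> (\<Sum>i=?N..<2*?N. real (g i))"
    using g by (intro sum_bounded_below) (auto simp: antimono_def)
  moreover have "(\<Sum>i<2*?N. real (g i)) = (\<Sum>i<?N. real (g i)) + (\<Sum>i=?N..<2*?N. real (g i))"
    by (simp add: lessThan_atLeast0 sum.atLeastLessThan_concat)
  ultimately show ?case using Suc by (simp add: algebra_simps)
qed

text \<open>The minimum is at most the geometric mean of \<open>T\<close> and \<open>h * L\<close>,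
  and AM-GM finishes. A linear right side can be summed over runs, heights and lengths
  separately.\<close>

lemma min_le_linear:
  fixes T h L \<alpha> \<beta> :: real
  assumes "0 \<le> T" "0 \<le> h" "0 \<le> L" "0 \<le> \<alpha>" "0 \<le> \<beta>" "T \<le> 4 * \<alpha> * \<beta>"
  shows "min T (h * L) \<le> \<alpha> * h + \<beta> * L"
proof (rule power2_le_imp_le)
  have hL: "0 \<le> h * L" using assms by simp
  have "(min T (h * L))\<^sup>2 \<le> T * (h * L)"
    unfolding power2_eq_square using assms hL by (intro mult_mono) auto
  also have "\<dots> \<le> 4 * \<alpha> * \<beta> * (h * L)" using assms hL by (intro mult_right_mono)
  also have "\<dots> \<le> (\<alpha> * h + \<beta> * L)\<^sup>2"
    using zero_le_power2[of "\<alpha> * h - \<beta> * L"] by (simp add: power2_eq_square algebra_simps)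
  finally show "(min T (h * L))\<^sup>2 \<le> (\<alpha> * h + \<beta> * L)\<^sup>2" .
  show "0 \<le> \<alpha> * h + \<beta> * L" using assms by simp
qed

lemma sum_dyadic_blocks:
  fixes f :: "nat \<Rightarrow> real"
  shows "(\<Sum>i<2^K * I. f i) = (\<Sum>i<I. f i) + (\<Sum>k<K. \<Sum>i=2^k * I..<2^Suc k * I. f i)"
proof (induction K)
  case (Suc K)
  have "(\<Sum>i<2^Suc K * I. f i) = (\<Sum>i<2^K * I. f i) + (\<Sum>i=2^K * I..<2^Suc K * I. f i)"
    by (simp add: lessThan_atLeast0 sum.atLeastLessThan_concat)
  then show ?case using Suc by simp
qed simp

text \<open>With \<open>r = sqrt (n / t)\<close>: rows below \<open>r\<close> contribute at most \<open>2 t\<close> each; rows between \<open>r\<close> and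
  \<open>t r\<close> are cut into about \<open>log 2 t\<close> dyadic blocks, on each of which \<open>\<alpha>\<close> is proportional to the row
  index so that \<open>\<alpha>\<close> times the drop is paid for by the total area \<open>2 n\<close>; from row \<open>t r\<close> on the rows
  have length at most \<open>2 n / (t r)\<close>, which bounds the number of sign changes.\<close>

lemma partition_distance_bound:
  fixes l m :: "nat \<Rightarrow> nat" and n t :: nat
  assumes l: "antimono l" and m: "antimono m"
    and suml: "\<And>N. (\<Sum>i<N. l i) \<le> n" and summ: "\<And>N. (\<Sum>i<N. m i) \<le> n"
    and D: "\<And>j. \<bar>(\<Sum>i<j. real (l i)) - (\<Sum>i<j. real (m i))\<bar> \<le> real t"
    and n: "1 \<le> n" and t: "2 \<le> t"
  shows "(\<Sum>i<n. \<bar>real (l i) - real (m i)\<bar>) \<le> 33 * sqrt (real n * real t * ln (real t))"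
proof -
  let ?e = "\<lambda>i. \<bar>real (l i) - real (m i)\<bar>"
  define X where "X = sqrt (real n * real t * ln (real t))"
  \<comment> \<open>A positive lower bound for \<open>ln t\<close> lets the terms \<open>Y\<close>
    and \<open>t\<close> be absorbed into multiples of \<open>X\<close>.\<close>
  have "exp (1/2) \<le> real t" using exp_half_le2 t by linarith
  then have lnt: "1/2 \<le> ln (real t)" using t by (subst ln_ge_iff) auto
  show ?thesis
  proof (cases "real n \<le> real t * ln (real t)")
    case True
    have "(\<Sum>i<n. ?e i) \<le> (\<Sum>i<n. real (l i) + real (m i))"
      by (intro sum_mono) linarith
    also have "\<dots> = real (\<Sum>i<n. l i) + real (\<Sum>i<n. m i)" by (simp add: sum.distrib)
    also have "\<dots> \<le> 2 * real n" using suml[of n] summ[of n] by linarith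
    finally have "(\<Sum>i<n. ?e i) \<le> 2 * real n" .
    moreover have "real n \<le> X" unfolding X_def
      using True by (intro real_le_rsqrt) (simp add: power2_eq_square mult.assoc mult_left_mono)
    ultimately show ?thesis unfolding X_def[symmetric] using n by linarith
  next
    case False
    then have small: "real t * ln (real t) \<le> real n" by simp
    define Y where "Y = sqrt (real n * real t)"
    define r where "r = sqrt (real n / real t)"
    define I where "I = nat \<lceil>r\<rceil>"
    define K where "K = nat \<lceil>log 2 (real t)\<rceil>"
    define J where "J = 2^K * I"
    \<comment> \<open>Balances, up to a constant factor, the drop cost
      \<open>2 * \<kappa> * n\<close> of all blocks against their length cost
      \<open>K * t / (2 * \<kappa>)\<close>.\<close>
    define \<kappa> where "\<kappa> = sqrt (real t * real K / real n)"
    define g where "g = (\<lambda>i. l i + m i)"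
    have tpos: "0 < real t" and npos: "0 < real n" using t n by auto
    have X0: "0 \<le> X" unfolding X_def using lnt by simp
    have tr: "real t * r = Y"
      unfolding r_def Y_def using tpos by (simp add: real_sqrt_divide real_sqrt_mult field_simps)
    have Ypos: "0 < Y" unfolding Y_def using tpos npos by simp
    have YY: "Y * Y = real n * real t" unfolding Y_def using tpos npos by simp
    have Y: "Y \<le> 2 * X"
    proof -
      have "real n * real t * 1 \<le> real n * real t * (4 * ln (real t))"
        using lnt by (intro mult_left_mono) auto
      then have "Y \<le> sqrt (2\<^sup>2 * (real n * real t * ln (real t)))"
        unfolding Y_def by (intro real_sqrt_le_mono) simp
      then show ?thesis unfolding X_def real_sqrt_mult[of "2\<^sup>2"] by simp
    qed
    have tln: "real t * ln (real t) \<le> X" unfolding X_def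
      using mult_right_mono[OF small, of "real t * ln (real t)"] lnt
      by (intro real_le_rsqrt) (simp add: power2_eq_square mult.assoc)
    have "real t * (1/2) \<le> real t * ln (real t)" using lnt by (intro mult_left_mono) auto
    then have tX: "real t \<le> 2 * X" using tln by linarith
    have rpos: "0 < r" unfolding r_def using tpos npos by simp
    have I: "r \<le> real I" "real I \<le> r + 1" "1 \<le> I"
      unfolding I_def using rpos by linarith+
    have log1: "1 \<le> log 2 (real t)" using t by (simp add: le_log_iff)
    have K1: "1 \<le> real K" "log 2 (real t) \<le> real K" "real K \<le> log 2 (real t) + 1"
      unfolding K_def using log1 by linarith+
    have "ln (2::real) \<ge> 1/2" using exp_half_le2 by (subst ln_ge_iff) auto
    then have "ln (real t) / ln 2 \<le> ln (real t) / (1/2)"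
      using lnt by (intro divide_left_mono) auto
    then have "log 2 (real t) \<le> 2 * ln (real t)" by (simp add: log_def)
    then have K4: "real K \<le> 4 * ln (real t)" using K1 log1 by linarith
    have "real t = 2 powr log 2 (real t)" using tpos by simp
    also have "\<dots> \<le> 2 powr real K" using K1 by (intro powr_mono) auto
    finally have tK: "real t \<le> 2 ^ K" by (simp add: powr_realpow)
    have JY: "Y \<le> real J"
      unfolding J_def tr[symmetric] using tK I rpos by (simp add: mult_mono)
    \<comment> \<open>A window of rows is a difference of two prefixes, each off by at most
      \<open>t\<close>.\<close>
    have T: "\<bar>\<Sum>i=a..<b. real (l i) - real (m i)\<bar> \<le> 2 * real t" for a b
    proof (cases "a \<le> b")
      case True
      have "(\<Sum>i=a..<b. real (l i) - real (m i))
        = (\<Sum>i<b. real (l i) - real (m i)) - (\<Sum>i<a. real (l i) - real (m i))"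
        using True by (simp add: lessThan_atLeast0 sum_diff_nat_ivl)
      then show ?thesis using D[of a] D[of b] by (simp add: sum_subtractf)
    qed simp
    have g: "antimono g" using l m unfolding g_def by (auto simp: monotone_on_def add_mono)
    have sumg: "(\<Sum>i<N. real (g i)) \<le> 2 * real n" for N
    proof -
      have "(\<Sum>i<N. g i) \<le> 2 * n" using suml[of N] summ[of N] by (simp add: g_def sum.distrib)
      then have "real (\<Sum>i<N. g i) \<le> real (2 * n)" by (rule of_nat_mono)
      then show ?thesis by simp
    qed
    have osc: "(\<Sum>i=a..<b. ?e i) \<le> 2 * real t + \<alpha> * (real (g a) - real (g b)) + \<beta> * (real b - real a)"
      if "\<And>h L :: nat. 1 \<le> h \<Longrightarrow> 1 \<le> L \<Longrightarrow> min (2 * real t) (real h * real L) \<le> \<alpha> * real h + \<beta> * real L"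
        "0 \<le> \<alpha>" "0 \<le> \<beta>" "a \<le> b" for a b \<alpha> \<beta>
      unfolding g_def by (rule oscillation_bound[OF l m T that])

    have "?e i \<le> 2 * real t" for i using T[of i "Suc i"] by simp
    then have "(\<Sum>i<I. ?e i) \<le> real (card {..<I}) * (2 * real t)" by (intro sum_bounded_above)
    also have "\<dots> \<le> (r + 1) * (2 * real t)" using I by (simp add: mult_right_mono)
    finally have head: "(\<Sum>i<I. ?e i) \<le> 2 * Y + 2 * real t" using tr by (simp add: algebra_simps)

    have \<kappa>: "0 < \<kappa>" unfolding \<kappa>_def using tpos npos K1 by simp
    have \<kappa>\<kappa>: "\<kappa> * \<kappa> = real t * real K / real n" unfolding \<kappa>_def using tpos npos by simp
    have block: "(\<Sum>i=2^k * I..<2^Suc k * I. ?e i) \<le> 2 * real t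
        + \<kappa> * (real (2^k * I) * (real (g (2^k * I)) - real (g (2^Suc k * I)))) + real t / (2 * \<kappa>)" for k
    proof -
      have N: "0 < real (2^k * I)" using I by simp
      \<comment> \<open>With \<open>N = 2^k * I\<close>, the weights
        \<open>\<alpha> = \<kappa> * N\<close> and \<open>\<beta> = t / (2 * \<kappa> * N)\<close>
        satisfy \<open>4 * \<alpha> * \<beta> = 2 * t\<close>. The block has \<open>N\<close> rows,
        so its length cost is the same for every \<open>k\<close>.\<close>
      have "(\<Sum>i=2^k * I..<2^Suc k * I. ?e i) \<le> 2 * real t
        + (\<kappa> * real (2^k * I)) * (real (g (2^k * I)) - real (g (2^Suc k * I)))
        + (real t / (2 * \<kappa> * real (2^k * I))) * (real (2^Suc k * I) - real (2^k * I))"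
        using \<kappa> N tpos I by (intro osc min_le_linear) (auto simp: field_simps)
      also have "real (2^Suc k * I) - real (2^k * I) = real (2^k * I)" by simp
      also have "real t / (2 * \<kappa> * real (2^k * I)) * real (2^k * I) = real t / (2 * \<kappa>)"
        using I by simp
      finally show ?thesis by (simp only: mult.assoc)
    qed
    have area: "(\<Sum>k<K. real (2^k * I) * (real (g (2^k * I)) - real (g (2^Suc k * I))))
        + real J * real (g J) \<le> 2 * real n"
      using dyadic_area[OF g, where K=K and I=I] sumg[of J] unfolding J_def by linarith
    moreover have "0 \<le> (\<Sum>k<K. real (2^k * I) * (real (g (2^k * I)) - real (g (2^Suc k * I))))"
      using g by (intro sum_nonneg mult_nonneg_nonneg) (auto simp: antimonoD)
    moreover have "0 \<le> real J * real (g J)" by simp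
    ultimately have JgJ: "real J * real (g J) \<le> 2 * real n"
      and drops: "(\<Sum>k<K. real (2^k * I) * (real (g (2^k * I)) - real (g (2^Suc k * I)))) \<le> 2 * real n"
      by linarith+
    have "(\<Sum>k<K. \<Sum>i=2^k * I..<2^Suc k * I. ?e i)
      \<le> (\<Sum>k<K. 2 * real t + \<kappa> * (real (2^k * I) * (real (g (2^k * I)) - real (g (2^Suc k * I)))) + real t / (2 * \<kappa>))"
      by (intro sum_mono block)
    also have "\<dots> = 2 * real t * real K
      + \<kappa> * (\<Sum>k<K. real (2^k * I) * (real (g (2^k * I)) - real (g (2^Suc k * I)))) + real K * (real t / (2 * \<kappa>))"
      by (simp add: sum.distrib sum_distrib_left)
    also have "\<dots> \<le> 2 * real t * real K + \<kappa> * (2 * real n) + real K * (real t / (2 * \<kappa>))"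
      using drops \<kappa> by (intro add_mono mult_left_mono) auto
    also have "real K * (real t / (2 * \<kappa>)) = \<kappa> * real n / 2"
      using \<kappa>\<kappa> \<kappa> npos by (simp add: field_simps)
    finally have mid: "(\<Sum>k<K. \<Sum>i=2^k * I..<2^Suc k * I. ?e i)
      \<le> 2 * (real t * real K) + (5/2) * (\<kappa> * real n)" by simp
    have "sqrt (real t * real K * real n) \<le> sqrt (2\<^sup>2 * (real n * real t * ln (real t)))"
      using K4 npos tpos by (intro real_sqrt_le_mono) simp
    also have "\<dots> = 2 * X" unfolding X_def real_sqrt_mult[of "2\<^sup>2"] by simp
    finally have sK: "sqrt (real t * real K * real n) \<le> 2 * X" .
    have "sqrt (real t * real K / real n) * sqrt (real n * real n)
      = sqrt (real t * real K * real n)"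
      unfolding real_sqrt_mult[symmetric] using npos by simp
    then have \<kappa>n: "\<kappa> * real n \<le> 2 * X" using sK by (simp add: \<kappa>_def)
    have "real t * real K \<le> real t * (4 * ln (real t))" using K4 by (intro mult_left_mono) auto
    then have tK4: "real t * real K \<le> 4 * X" using tln by linarith

    \<comment> \<open>Far down, lengths may be large but drops are few: with
      \<open>\<alpha> = 2 * t\<close> and \<open>\<beta> = 0\<close> each run pays through its
      height, which is at least 1.\<close>
    have "(\<Sum>i=J..<J + n. ?e i)
      \<le> 2 * real t + (2 * real t) * (real (g J) - real (g (J + n))) + 0 * (real (J + n) - real J)"
    proof (intro osc)
      fix h L :: nat
      assume "1 \<le> h"
      then have "2 * real t * 1 \<le> 2 * real t * real h" by (intro mult_left_mono) auto
      then show "min (2 * real t) (real h * real L) \<le> 2 * real t * real h + 0 * real L" by simp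
    qed auto
    also have "\<dots> \<le> 2 * real t + 2 * (real t * real (g J))"
      by (simp add: mult_left_mono)
    finally have "(\<Sum>i=J..<J + n. ?e i) \<le> 2 * real t + 2 * (real t * real (g J))" .
    moreover have "real t * real (g J) \<le> 2 * Y"
    proof -
      have "Y * real (g J) \<le> 2 * real n"
        using mult_right_mono[OF JY, of "real (g J)"] JgJ by linarith
      then have "real t * (Y * real (g J)) \<le> 2 * (Y * Y)" 
        using tpos YY mult_left_mono[of "Y * real (g J)" "2 * real n" "real t"] by (simp add: mult.commute)
      then have "Y * (real t * real (g J)) \<le> Y * (2 * Y)" by (simp add: algebra_simps)
      then show ?thesis using Ypos by simp
    qed
    ultimately have tail: "(\<Sum>i=J..<J + n. ?e i) \<le> 2 * real t + 4 * Y" by linarith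

    \<comment> \<open>\<open>J\<close> may exceed \<open>n\<close>; extending the range avoids a
      case distinction.\<close>
    have "(\<Sum>i<n. ?e i) \<le> (\<Sum>i<J + n. ?e i)" by (intro sum_mono2) auto
    also have "\<dots> = (\<Sum>i<J. ?e i) + (\<Sum>i=J..<J + n. ?e i)"
      by (simp add: lessThan_atLeast0 sum.atLeastLessThan_concat)
    also have "(\<Sum>i<J. ?e i) = (\<Sum>i<I. ?e i) + (\<Sum>k<K. \<Sum>i=2^k * I..<2^Suc k * I. ?e i)"
      unfolding J_def by (rule sum_dyadic_blocks)
    \<comment> \<open>In multiples of \<open>X\<close>: head 4 + 4, blocks 8 + 5, tail 4 + 8,
      together 33.\<close>
    finally show ?thesis
      unfolding X_def[symmetric] using head mid tail \<kappa>n tK4 tX Y by simp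
  qed
qed

section \<open>Greene invariants and Knuth equivalence\<close>

text \<open>By Mirsky's theorem a word without decreasing subsequences longer than \<open>j\<close> is a union of
  \<open>j\<close> increasing ones, so \<open>greene j w\<close> is Greene's invariant. Bounding decreasing
  subsequences instead of exhibiting the increasing ones makes Knuth invariance a local matter.\<close>

definition dec_bounded :: "nat \<Rightarrow> 'a::linorder list \<Rightarrow> bool" where
  "dec_bounded j s \<longleftrightarrow> (\<forall>ys. subseq ys s \<longrightarrow> sorted_wrt (>) ys \<longrightarrow> length ys \<le> j)"

definition greene :: "nat \<Rightarrow> 'a::linorder list \<Rightarrow> nat" where
  "greene j w = Max {length s | s. subseq s w \<and> dec_bounded j s}"

lemma finite_greene: "finite {length s | s. subseq s w \<and> dec_bounded j s}"
  by (rule finite_subset[of _ "{..length w}"]) (auto dest: list_emb_length)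

lemma greene_upper: "subseq s w \<Longrightarrow> dec_bounded j s \<Longrightarrow> length s \<le> greene j w"
  unfolding greene_def by (intro Max_ge finite_greene) auto

lemma greene_attained:
  obtains s where "subseq s w" "dec_bounded j s" "length s = greene j w"
proof -
  have "{length s | s. subseq s w \<and> dec_bounded j s} \<noteq> {}"
    by (auto simp: dec_bounded_def intro!: exI[of _ "[]"] dest: list_emb_length)
  then have "greene j w \<in> {length s | s. subseq s w \<and> dec_bounded j s}"
    unfolding greene_def by (intro Max_in finite_greene)
  then show ?thesis using that by auto
qed

lemma dec_bounded_append3:
  "dec_bounded j (p @ m @ q) \<longleftrightarrow>
    (\<forall>a c b. subseq a p \<longrightarrow> subseq c m \<longrightarrow> subseq b q \<longrightarrow> sorted_wrt (>) (a @ c @ b)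
      \<longrightarrow> length a + length c + length b \<le> j)"
  unfolding dec_bounded_def subseq_append_iff by fastforce

lemma subseq2_iff: "subseq c [x, y] \<longleftrightarrow> c \<in> {[], [x], [y], [x, y]}"
  unfolding in_set_subseqs[symmetric] by (auto simp: Let_def)

lemma subseq3_iff:
  "subseq c [x, y, z] \<longleftrightarrow> c \<in> {[], [x], [y], [z], [x, y], [x, z], [y, z], [x, y, z]}"
  unfolding in_set_subseqs[symmetric] by (auto simp: Let_def)

lemma dec_bounded_sort2:
  assumes "dec_bounded j (p @ [z, x] @ q)" "x < z"
  shows "dec_bounded j (p @ [x, z] @ q)"
  unfolding dec_bounded_append3
proof (intro allI impI)
  fix a c b
  assume h: "subseq a p" "subseq c [x, z]" "subseq b q" "sorted_wrt (>) (a @ c @ b)"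
  then have "subseq c [z, x]"
    using assms(2) unfolding subseq2_iff by (auto simp: sorted_wrt_append)
  then show "length a + length c + length b \<le> j"
    using assms(1) h unfolding dec_bounded_append3 by blast
qed

text \<open>The only new decreasing choice is \<open>[z, x]\<close>. It can be traded for
  \<open>[y, x]\<close>, since whatever stands above \<open>z\<close> is also above
  \<open>y\<close>; the next lemma is the mirror image, trading \<open>[z, x]\<close> for
  \<open>[z, y]\<close>.\<close>

lemma dec_bounded_swap1:
  assumes "dec_bounded j (p @ [y, x, z] @ q)" "x < y" "y < z"
  shows "dec_bounded j (p @ [y, z, x] @ q)"
  unfolding dec_bounded_append3
proof (intro allI impI)
  fix a c b
  assume h: "subseq a p" "subseq c [y, z, x]" "subseq b q" "sorted_wrt (>) (a @ c @ b)"
  have *: "length a + length c + length b \<le> j"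
    if "subseq c [y, x, z]" "sorted_wrt (>) (a @ c @ b)" for c
    using assms(1) h that unfolding dec_bounded_append3 by blast
  have "c \<in> {[], [y], [z], [x], [y, x]} \<or> c = [z, x]"
    using h assms(2,3) unfolding subseq3_iff by (auto simp: sorted_wrt_append)
  then show "length a + length c + length b \<le> j"
  proof
    assume "c \<in> {[], [y], [z], [x], [y, x]}"
    then show ?thesis by (intro * h(4)) (auto simp: subseq3_iff)
  next
    assume c: "c = [z, x]"
    have "sorted_wrt (>) (a @ [y, x] @ b)"
      using h(4) assms(2,3) unfolding c by (fastforce simp: sorted_wrt_append)
    from *[OF _ this] show ?thesis unfolding c by (simp add: subseq3_iff)
  qed
qed

lemma dec_bounded_swap2:
  assumes "dec_bounded j (p @ [x, z, y] @ q)" "x < y" "y < z"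
  shows "dec_bounded j (p @ [z, x, y] @ q)"
  unfolding dec_bounded_append3
proof (intro allI impI)
  fix a c b
  assume h: "subseq a p" "subseq c [z, x, y]" "subseq b q" "sorted_wrt (>) (a @ c @ b)"
  have *: "length a + length c + length b \<le> j"
    if "subseq c [x, z, y]" "sorted_wrt (>) (a @ c @ b)" for c
    using assms(1) h that unfolding dec_bounded_append3 by blast
  have "c \<in> {[], [y], [z], [x], [z, y]} \<or> c = [z, x]"
    using h assms(2,3) unfolding subseq3_iff by (auto simp: sorted_wrt_append)
  then show "length a + length c + length b \<le> j"
  proof
    assume "c \<in> {[], [y], [z], [x], [z, y]}"
    then show ?thesis by (intro * h(4)) (auto simp: subseq3_iff)
  next
    assume c: "c = [z, x]"
    have "sorted_wrt (>) (a @ [z, y] @ b)"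
      using h(4) assms(2,3) unfolding c by (fastforce simp: sorted_wrt_append)
    from *[OF _ this] show ?thesis unfolding c by (simp add: subseq3_iff)
  qed
qed

text \<open>A decreasing sequence of length \<open>j + 1\<close> that uses both \<open>z\<close> and \<open>x\<close> forces the longest
  decreasing sequences arriving above \<open>z\<close> and leaving below \<open>x\<close> to be as long as those for \<open>y\<close>;
  hence \<open>y\<close> can stand in for either of the two letters.\<close>

lemma dec_bounded_exchange:
  assumes dec: "dec_bounded j (p @ [x, z] @ q)" and "x < y" "y < z"
    and not: "\<not> dec_bounded j (p @ [z, x] @ q)"
  shows "dec_bounded j (p @ [y, z] @ q)" and "dec_bounded j (p @ [x, y] @ q)"
proof -
  have low: "length a + length c + length b \<le> j"
    if "subseq a p" "subseq c [x, z]" "subseq b q" "sorted_wrt (>) (a @ c @ b)" for a c b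
    using dec that unfolding dec_bounded_append3 by blast
  obtain a c b where abc: "subseq a p" "subseq c [z, x]" "subseq b q"
      "sorted_wrt (>) (a @ c @ b)" "j < length a + length c + length b"
    using not unfolding dec_bounded_append3 by (auto simp: not_le)
  have c: "c = [z, x]"
    using abc low[OF abc(1) _ abc(3,4)] unfolding subseq2_iff by fastforce
  \<comment> \<open>Recombine the halves: \<open>a', x, b\<close> and \<open>a, z, b'\<close> are
    decreasing and admissible. Adding their two bounds and subtracting
    \<open>length a + 2 + length b > j\<close> leaves the claim.\<close>
  have mid: "length a' + 1 + length b' \<le> j"
    if h: "subseq a' p" "subseq b' q" "sorted_wrt (>) (a' @ [y] @ b')" for a' b'
  proof -
    have "length a' + length [x] + length b \<le> j"
      using h abc c \<open>x < y\<close> by (intro low) (fastforce simp: sorted_wrt_append)+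
    moreover have "length a + length [z] + length b' \<le> j"
      using h abc c \<open>y < z\<close> by (intro low) (fastforce simp: sorted_wrt_append)+
    ultimately show ?thesis using abc(5) c by simp
  qed
  show "dec_bounded j (p @ [y, z] @ q)"
    unfolding dec_bounded_append3
  proof (intro allI impI)
    fix a c b
    assume h: "subseq a p" "subseq c [y, z]" "subseq b q" "sorted_wrt (>) (a @ c @ b)"
    then have "c = [] \<or> c = [y] \<or> c = [z]"
      using \<open>y < z\<close> by (auto simp: subseq2_iff sorted_wrt_append)
    then show "length a + length c + length b \<le> j"
      using mid[of a b] low[of a c b] h by (auto simp: subseq2_iff)
  qed
  show "dec_bounded j (p @ [x, y] @ q)"
    unfolding dec_bounded_append3
  proof (intro allI impI)
    fix a c b
    assume h: "subseq a p" "subseq c [x, y]" "subseq b q" "sorted_wrt (>) (a @ c @ b)"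
    then have "c = [] \<or> c = [y] \<or> c = [x]"
      using \<open>x < y\<close> by (auto simp: subseq2_iff sorted_wrt_append)
    then show "length a + length c + length b \<le> j"
      using mid[of a b] low[of a c b] h by (auto simp: subseq2_iff)
  qed
qed

section \<open>Invariance of Greene's numbers under the Knuth relations\<close>

text \<open>The slack \<open>d\<close> is 0 for a Knuth move and 1 for an adjacent transposition of
  values.\<close>

lemma greene_leI:
  assumes "\<And>s. subseq s w \<Longrightarrow> dec_bounded j s \<Longrightarrow>
    \<exists>s'. subseq s' w' \<and> dec_bounded j s' \<and> length s \<le> length s' + d"
  shows "greene j w \<le> greene j w' + d"
proof -
  obtain s where "subseq s w" "dec_bounded j s" "length s = greene j w"
    by (rule greene_attained)
  then show ?thesis using assms[of s] greene_upper[of _ w' j] by fastforce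
qed

lemma greene_le_replace:
  assumes "\<And>p m q. subseq m a \<Longrightarrow> dec_bounded j (p @ m @ q) \<Longrightarrow>
    \<exists>m'. subseq m' b \<and> length m' = length m \<and> dec_bounded j (p @ m' @ q)"
  shows "greene j (u @ a @ v) \<le> greene j (u @ b @ v)"
proof -
  have "greene j (u @ a @ v) \<le> greene j (u @ b @ v) + 0"
  proof (rule greene_leI)
    fix s
    assume "subseq s (u @ a @ v)" "dec_bounded j s"
    then obtain p m q where s: "s = p @ m @ q" "subseq p u" "subseq m a" "subseq q v"
      by (auto simp: subseq_append_iff)
    obtain m' where "subseq m' b" "length m' = length m" "dec_bounded j (p @ m' @ q)"
      using assms[of m p q] s \<open>dec_bounded j s\<close> by auto
    then show "\<exists>s'. subseq s' (u @ b @ v) \<and> dec_bounded j s' \<and> length s \<le> length s' + 0"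
      using s by (intro exI[of _ "p @ m' @ q"]) (auto intro!: list_emb_append_mono)
  qed
  then show ?thesis by simp
qed

text \<open>The critical case is a selection that contains \<open>x\<close> and \<open>z\<close> but
  omits \<open>y\<close>: reversing the pair may create a decreasing sequence that is too long. In
  that event \<open>dec_bounded_exchange\<close> selects \<open>y\<close> in place of
  \<open>x\<close>, at equal length. The converse direction only turns descents into
  ascents.\<close>

lemma greene_knuth1:
  assumes xy: "x < y" and yz: "y < z"
  shows "greene j (u @ [y, x, z] @ v) = greene j (u @ [y, z, x] @ v)"
proof (rule antisym; rule greene_le_replace)
  fix p m q assume m: "subseq m [y, x, z]" and dec: "dec_bounded j (p @ m @ q)"
  consider "subseq m [y, z, x]" | "m = [x, z]" | "m = [y, x, z]"
    using m by (auto simp: subseq3_iff)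
  then show "\<exists>m'. subseq m' [y, z, x] \<and> length m' = length m \<and> dec_bounded j (p @ m' @ q)"
  proof cases
    case 2
    show ?thesis
    proof (cases "dec_bounded j (p @ [z, x] @ q)")
      case False
      then have "dec_bounded j (p @ [y, z] @ q)"
        using dec_bounded_exchange(1)[of j p x z q y] dec xy yz unfolding 2 by blast
      then show ?thesis unfolding 2 by (intro exI[of _ "[y, z]"]) (simp add: subseq3_iff)
    next
      case True
      then show ?thesis unfolding 2 by (intro exI[of _ "[z, x]"]) (simp add: subseq3_iff)
    qed
  next
    case 3
    show ?thesis using dec_bounded_swap1[OF dec[unfolded 3] xy yz]
      by (intro exI[of _ "[y, z, x]"]) (simp add: 3)
  qed (use dec in blast)
next
  fix p m q assume m: "subseq m [y, z, x]" and dec: "dec_bounded j (p @ m @ q)"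
  consider "subseq m [y, x, z]" | "m = [z, x]" | "m = [y, z, x]"
    using m by (auto simp: subseq3_iff)
  then show "\<exists>m'. subseq m' [y, x, z] \<and> length m' = length m \<and> dec_bounded j (p @ m' @ q)"
  proof cases
    case 2
    show ?thesis using dec_bounded_sort2[OF dec[unfolded 2] less_trans[OF xy yz]]
      by (intro exI[of _ "[x, z]"]) (simp add: 2 subseq3_iff)
  next
    case 3
    have "dec_bounded j ((p @ [y]) @ [z, x] @ q)" using dec unfolding 3 by simp
    from dec_bounded_sort2[OF this less_trans[OF xy yz]] show ?thesis
      by (intro exI[of _ "[y, x, z]"]) (simp add: 3)
  qed (use dec in blast)
qed

lemma greene_knuth2:
  assumes xy: "x < y" and yz: "y < z"
  shows "greene j (u @ [x, z, y] @ v) = greene j (u @ [z, x, y] @ v)"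
proof (rule antisym; rule greene_le_replace)
  fix p m q assume m: "subseq m [x, z, y]" and dec: "dec_bounded j (p @ m @ q)"
  consider "subseq m [z, x, y]" | "m = [x, z]" | "m = [x, z, y]"
    using m by (auto simp: subseq3_iff)
  then show "\<exists>m'. subseq m' [z, x, y] \<and> length m' = length m \<and> dec_bounded j (p @ m' @ q)"
  proof cases
    case 2
    show ?thesis
    proof (cases "dec_bounded j (p @ [z, x] @ q)")
      case False
      then have "dec_bounded j (p @ [x, y] @ q)"
        using dec_bounded_exchange(2)[of j p x z q y] dec xy yz unfolding 2 by blast
      then show ?thesis unfolding 2 by (intro exI[of _ "[x, y]"]) (simp add: subseq3_iff)
    next
      case True
      then show ?thesis unfolding 2 by (intro exI[of _ "[z, x]"]) (simp add: subseq3_iff)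
    qed
  next
    case 3
    show ?thesis using dec_bounded_swap2[OF dec[unfolded 3] xy yz]
      by (intro exI[of _ "[z, x, y]"]) (simp add: 3)
  qed (use dec in blast)
next
  fix p m q assume m: "subseq m [z, x, y]" and dec: "dec_bounded j (p @ m @ q)"
  consider "subseq m [x, z, y]" | "m = [z, x]" | "m = [z, x, y]"
    using m by (auto simp: subseq3_iff)
  then show "\<exists>m'. subseq m' [x, z, y] \<and> length m' = length m \<and> dec_bounded j (p @ m' @ q)"
  proof cases
    case 2
    show ?thesis using dec_bounded_sort2[OF dec[unfolded 2] less_trans[OF xy yz]]
      by (intro exI[of _ "[x, z]"]) (simp add: 2 subseq3_iff)
  next
    case 3
    have "dec_bounded j (p @ [z, x] @ ([y] @ q))" using dec unfolding 3 by simp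
    from dec_bounded_sort2[OF this less_trans[OF xy yz]] show ?thesis
      by (intro exI[of _ "[x, z, y]"]) (simp add: 3)
  qed (use dec in blast)
qed

section \<open>Knuth moves that carry out an insertion into one row\<close>

text \<open>The two elementary relations are oriented in the direction in which row insertion
  applies them.\<close>

inductive knuth :: "'a::linorder list \<Rightarrow> 'a list \<Rightarrow> bool" where
  refl: "knuth w w"
| trans: "knuth u v \<Longrightarrow> knuth v w \<Longrightarrow> knuth u w"
| yzx: "x < y \<Longrightarrow> y < z \<Longrightarrow> knuth (u @ [y, z, x] @ v) (u @ [y, x, z] @ v)"
| xzy: "x < y \<Longrightarrow> y < z \<Longrightarrow> knuth (u @ [x, z, y] @ v) (u @ [z, x, y] @ v)"

lemma greene_knuth: "knuth w w' \<Longrightarrow> greene j w = greene j w'"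
proof (induction rule: knuth.induct)
  case (yzx x y z u v)
  then show ?case using greene_knuth1[of x y z] by metis
next
  case (xzy x y z u v)
  then show ?case by (rule greene_knuth2)
qed auto

lemma knuth_append: "knuth w w' \<Longrightarrow> knuth (a @ w @ b) (a @ w' @ b)"
proof (induction rule: knuth.induct)
  case (yzx x y z u v)
  then show ?case using knuth.yzx[of x y z "a @ u" "v @ b"] by simp
next
  case (xzy x y z u v)
  then show ?case using knuth.xzy[of x y z "a @ u" "v @ b"] by simp
qed (auto intro: knuth.refl knuth.trans)

text \<open>\<open>x\<close> travels left through \<open>v\<close>; at each letter \<open>z\<close>
  the left neighbour \<open>q\<close> of \<open>z\<close>, with \<open>x < q < z\<close>, licenses
  the exchange.\<close>

lemma knuth_insert_right:
  assumes "x < y" "sorted_wrt (<) (y # v)"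
  shows "knuth (y # v @ [x]) (y # x # v)"
  using assms(2)
proof (induction v rule: rev_induct)
  case (snoc z v)
  obtain u q where uq: "y # v = u @ [q]" by (metis list.distinct(1) rev_exhaust)
  then have "q \<in> set (y # v)" by simp
  then have q: "x < q" "q < z" using snoc.prems assms(1) by (auto simp: sorted_wrt_append)
  have "knuth (u @ [q, z, x] @ []) (u @ [q, x, z] @ [])" using q by (rule knuth.yzx)
  moreover have "u @ [q, z, x] = y # v @ [z, x]" "u @ [q, x, z] = (y # v @ [x]) @ [z]"
    using uq by simp_all
  moreover have "knuth ((y # v @ [x]) @ [z]) ((y # x # v) @ [z])"
    using snoc knuth_append[of "y # v @ [x]" "y # x # v" "[]" "[z]"] by (simp add: sorted_wrt_append)
  ultimately show ?case by (auto intro: knuth.trans)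
qed (auto intro: knuth.refl)

text \<open>\<open>y\<close> travels left through \<open>u\<close>; at each letter \<open>p\<close>
  the right neighbour of \<open>y\<close>, which lies between \<open>p\<close> and \<open>y\<close>,
  licenses the exchange.\<close>

lemma knuth_bump_left:
  assumes "sorted_wrt (<) (u @ [x])" "x < y"
  shows "knuth (u @ [y, x]) (y # u @ [x])"
  using assms
proof (induction u arbitrary: x rule: rev_induct)
  case (snoc p u)
  have p: "p < x" "p < y" using snoc.prems by (auto simp: sorted_wrt_append)
  have "knuth (u @ [p, y, x] @ []) (u @ [y, p, x] @ [])"
    using p snoc.prems by (intro knuth.xzy) auto
  moreover have "knuth ([] @ (u @ [y, p]) @ [x]) ([] @ (y # u @ [p]) @ [x])"
    using snoc p by (intro knuth_append snoc.IH) (auto simp: sorted_wrt_append)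
  ultimately show ?case by (auto intro: knuth.trans)
qed (auto intro: knuth.refl)

lemma knuth_row:
  assumes "sorted_wrt (<) (u @ y # v)" "x < y" "\<forall>z\<in>set u. z < x"
  shows "knuth (u @ y # v @ [x]) (y # u @ x # v)"
proof -
  have "knuth (u @ (y # v @ [x]) @ []) (u @ (y # x # v) @ [])"
    using assms by (intro knuth_append knuth_insert_right) (auto simp: sorted_wrt_append)
  moreover have "knuth ([] @ (u @ [y, x]) @ v) ([] @ (y # u @ [x]) @ v)"
    using assms by (intro knuth_append knuth_bump_left) (auto simp: sorted_wrt_append)
  ultimately show ?thesis by (auto intro: knuth.trans)
qed

section \<open>Row insertion\<close>

definition row0 :: "nat list list \<Rightarrow> nat list" where
  "row0 T = (case T of [] \<Rightarrow> [] | r # _ \<Rightarrow> r)"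

lemma row0_simps [simp]: "row0 [] = []" "row0 (r # rs) = r"
  by (simp_all add: row0_def)

definition insert_pos :: "nat list \<Rightarrow> nat \<Rightarrow> nat" where
  "insert_pos r x = length (takeWhile (\<lambda>z. z < x) r)"

text \<open>When \<open>insert_pos r x = length r\<close> this appends \<open>x\<close>, otherwise it bumps the entry at that
  position; treating an absent row as empty makes \<open>row_insert_eq\<close> uniform.\<close>

definition insert_row :: "nat list \<Rightarrow> nat \<Rightarrow> nat list" where
  "insert_row r x = take (insert_pos r x) r @ x # drop (Suc (insert_pos r x)) r"

lemma insert_pos_le: "insert_pos r x \<le> length r"
  by (simp add: insert_pos_def length_takeWhile_le)

lemma nth_less_insert_pos: "i < insert_pos r x \<Longrightarrow> r ! i < x"
  unfolding insert_pos_def by (metis (full_types) nth_mem set_takeWhileD takeWhile_nth)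

lemma insert_pos_nth: "insert_pos r x < length r \<Longrightarrow> x \<le> r ! insert_pos r x"
  unfolding insert_pos_def using nth_length_takeWhile not_le by blast

lemma length_insert_row: "length (insert_row r x) = max (length r) (Suc (insert_pos r x))"
  using insert_pos_le[of r x] unfolding insert_row_def
  by (cases "insert_pos r x < length r") (auto simp: max_def)

lemma nth_insert_row:
  "i < length (insert_row r x) \<Longrightarrow> insert_row r x ! i = (if i = insert_pos r x then x else r ! i)"
  using insert_pos_le[of r x] unfolding length_insert_row
  by (auto simp: insert_row_def nth_append nth_Cons' min_def)

lemma row_insert_eq:
  "row_insert T x = insert_row (row0 T) x #
    (if insert_pos (row0 T) x < length (row0 T)
     then row_insert (tl T) (row0 T ! insert_pos (row0 T) x) else tl T)"
proof (cases T)
  case Nil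
  then show ?thesis by (simp add: insert_row_def insert_pos_def)
next
  case (Cons r rs)
  let ?k = "insert_pos r x"
  have tw: "takeWhile (\<lambda>z. z < x) r = take ?k r" and dw: "dropWhile (\<lambda>z. z < x) r = drop ?k r"
    unfolding insert_pos_def by (rule takeWhile_eq_take, rule dropWhile_eq_drop)
  have all: "(\<forall>y\<in>set r. y < x) \<longleftrightarrow> ?k = length r"
  proof -
    have "(\<forall>y\<in>set r. y < x) \<longleftrightarrow> takeWhile (\<lambda>z. z < x) r = r"
      by (simp add: takeWhile_eq_all_conv)
    also have "\<dots> \<longleftrightarrow> ?k = length r"
      using tw insert_pos_le[of r x] by auto
    finally show ?thesis .
  qed
  show ?thesis
  proof (cases "?k = length r")
    case True
    then show ?thesis using all Cons by (simp add: insert_row_def)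
  next
    case False
    then have k: "?k < length r" using insert_pos_le[of r x] by simp
    have not: "\<not> (\<forall>y\<in>set r. y < x)" using all False by simp
    show ?thesis
      unfolding Cons row0_simps row_insert.simps list.sel if_not_P[OF not] if_P[OF k] tw dw
      using k by (simp add: insert_row_def hd_drop_conv_nth drop_Suc tl_drop)
  qed
qed

section \<open>Insertion preserves tableaux and the Knuth class of the reading word\<close>

definition above :: "nat list \<Rightarrow> nat list \<Rightarrow> bool" where
  "above r r' \<longleftrightarrow> length r' \<le> length r \<and> (\<forall>i<length r'. r ! i < r' ! i)"

fun tableau :: "nat list list \<Rightarrow> bool" where
  "tableau [] \<longleftrightarrow> True"
| "tableau (r # rs) \<longleftrightarrow> r \<noteq> [] \<and> sorted_wrt (<) r \<and> above r (row0 rs) \<and> tableau rs"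

lemma sorted_insert_row:
  assumes "sorted_wrt (<) r" "x \<notin> set r"
  shows "sorted_wrt (<) (insert_row r x)"
  unfolding sorted_wrt_iff_nth_less
proof (intro allI impI)
  fix i j assume ij: "i < j" "j < length (insert_row r x)"
  let ?k = "insert_pos r x"
  have le: "r ! a < r ! b" if "a < b" "b < length r" for a b
    using assms(1) that by (simp add: sorted_wrt_iff_nth_less)
  have j: "j < length r \<or> j = ?k"
    using ij(2) insert_pos_le[of r x] by (auto simp: length_insert_row max_def split: if_splits)
  consider "i = ?k" | "j = ?k" | "i \<noteq> ?k" "j \<noteq> ?k" by blast
  then show "insert_row r x ! i < insert_row r x ! j"
  proof cases
    case 1
    then have "j < length r" using j ij by simp
    then have "x \<le> r ! ?k" using 1 ij by (intro insert_pos_nth) simp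
    also have "r ! ?k < r ! j" using le 1 ij \<open>j < length r\<close> by simp
    finally show ?thesis using 1 ij by (simp add: nth_insert_row)
  next
    case 2
    then show ?thesis using ij nth_less_insert_pos[of i r x] by (simp add: nth_insert_row)
  next
    case 3
    then show ?thesis using ij le j by (simp add: nth_insert_row)
  qed
qed

lemma mset_insert_row:
  "mset (insert_row r x) + (if insert_pos r x < length r then {#r ! insert_pos r x#} else {#})
    = add_mset x (mset r)"
proof (cases "insert_pos r x < length r")
  case True
  then have "mset r = mset (take (insert_pos r x) r @ r ! insert_pos r x # drop (Suc (insert_pos r x)) r)"
    by (simp add: id_take_nth_drop[symmetric])
  then show ?thesis using True by (simp add: insert_row_def)
next
  case False
  then show ?thesis using insert_pos_le[of r x] by (simp add: insert_row_def)
qed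

lemma mset_row_insert: "mset (concat (row_insert T x)) = add_mset x (mset (concat T))"
proof (induction T arbitrary: x)
  case Nil
  then show ?case by simp
next
  case (Cons r rs)
  show ?case
    using mset_insert_row[of r x] Cons.IH[of "r ! insert_pos r x"]
    by (subst row_insert_eq) (auto split: if_splits)
qed

text \<open>Bumping moves weakly left: the entry below the bumped \<open>y\<close> exceeds
  \<open>y\<close>, so \<open>y\<close> settles in a column \<open>k' \<le> k\<close>. There the
  entry above it is either \<open>x\<close> or an old entry smaller than \<open>x\<close>, hence
  below \<open>y\<close>. In the other columns the upper row has only become smaller.\<close>

lemma above_insert_row:
  assumes ab: "above r r'" and lt: "insert_pos r x < length r" and x: "x < r ! insert_pos r x"
    and r: "sorted_wrt (<) r"
  shows "above (insert_row r x) (insert_row r' (r ! insert_pos r x))"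
proof -
  define k where "k = insert_pos r x"
  define y where "y = r ! k"
  define k' where "k' = insert_pos r' y"
  have len: "length r' \<le> length r" and nth: "\<And>i. i < length r' \<Longrightarrow> r ! i < r' ! i"
    using ab by (auto simp: above_def)
  have xy: "x < y" and kl: "k < length r" using x lt by (simp_all add: y_def k_def)
  have kk: "k' \<le> k"
  proof (rule ccontr)
    assume "\<not> k' \<le> k"
    then have "r' ! k < y" "k < length r'"
      using nth_less_insert_pos[of k r' y] insert_pos_le[of r' y] by (auto simp: k'_def)
    then show False using nth[of k] by (simp add: y_def)
  qed
  have *: "insert_row r x ! i < insert_row r' y ! i" if i: "i < length (insert_row r' y)" for i
  proof -
    have ir: "i < length (insert_row r x)"
      using i len kk kl by (auto simp: length_insert_row k'_def[symmetric])
    have rx: "insert_row r x ! i \<le> (if i = k then x else r ! i)"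
      using nth_insert_row[OF ir] by (simp add: k_def)
    show ?thesis
    proof (cases "i = k'")
      case True
      have "insert_row r x ! i < y"
      proof (cases "i = k")
        case False
        then show ?thesis using True kk rx nth_less_insert_pos[of i r x] xy by (simp add: k_def)
      qed (use rx xy in simp)
      then show ?thesis using nth_insert_row[OF i] True by (simp add: k'_def)
    next
      case False
      then have "i < length r'"
        using i insert_pos_le[of r' y] by (auto simp: length_insert_row k'_def max_def split: if_splits)
      then show ?thesis
        using nth_insert_row[OF i] False rx nth[of i] xy by (auto simp: k'_def y_def split: if_splits)
    qed
  qed
  have "length (insert_row r' y) \<le> length (insert_row r x)"
    using len kk kl by (simp add: length_insert_row k'_def[symmetric] le_max_iff_disj)
  with * show ?thesis unfolding above_def y_def k_def by blast
qed

lemma above_insert_end: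
  assumes "above r r'" "\<not> insert_pos r x < length r"
  shows "above (insert_row r x) r'"
proof -
  have "insert_pos r x = length r" using assms insert_pos_le[of r x] by simp
  then show ?thesis using assms(1)
    by (auto simp: above_def length_insert_row nth_insert_row)
qed

lemma row0_row_insert: "row0 (row_insert T x) = insert_row (row0 T) x"
  by (subst row_insert_eq) simp

lemma tableau_row_insert:
  assumes "tableau T" "distinct (concat T)" "x \<notin> set (concat T)"
  shows "tableau (row_insert T x)"
  using assms
proof (induction T arbitrary: x)
  case Nil
  then show ?case by (simp add: above_def)
next
  case (Cons r rs)
  have r: "sorted_wrt (<) (insert_row r x)"
    using Cons.prems by (intro sorted_insert_row) auto
  have ne: "insert_row r x \<noteq> []" by (simp add: insert_row_def)
  show ?case
  proof (cases "insert_pos r x < length r")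
    case True
    let ?y = "r ! insert_pos r x"
    have y: "?y \<in> set r" using True by simp
    then have "x < ?y" using insert_pos_nth[OF True] Cons.prems(3) by (cases "x = ?y") auto
    then have "above (insert_row r x) (insert_row (row0 rs) ?y)"
      using True Cons.prems by (intro above_insert_row) auto
    moreover have "tableau (row_insert rs ?y)"
      using Cons.prems y by (intro Cons.IH) auto
    ultimately show ?thesis
      using True r ne by (subst row_insert_eq) (simp add: row0_row_insert)
  next
    case False
    then show ?thesis
      using r ne above_insert_end[OF _ False] Cons.prems by (subst row_insert_eq) simp
  qed
qed

text \<open>Rows are read from bottom to top, so \<open>x\<close> arrives next to the top row, and
  the bumped letter comes out directly after the lower rows, where the insertion continues.\<close>

lemma knuth_row_insert:
  assumes "tableau T" "distinct (concat T)" "x \<notin> set (concat T)"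
  shows "knuth (concat (rev T) @ [x]) (concat (rev (row_insert T x)))"
  using assms
proof (induction T arbitrary: x)
  case Nil
  then show ?case by (simp add: knuth.refl)
next
  case (Cons r rs)
  show ?case
  proof (cases "insert_pos r x < length r")
    case True
    let ?k = "insert_pos r x"
    let ?y = "r ! ?k" and ?u = "take ?k r" and ?v = "drop (Suc ?k) r"
    have y: "?y \<in> set r" using True by simp
    then have xy: "x < ?y" using insert_pos_nth[OF True] Cons.prems(3) by (cases "x = ?y") auto
    have r: "r = ?u @ ?y # ?v" using True by (rule id_take_nth_drop)
    have "\<forall>z\<in>set ?u. z < x"
      using nth_less_insert_pos[of _ r x] by (auto simp: in_set_conv_nth)
    moreover have "sorted_wrt (<) (?u @ ?y # ?v)" using Cons.prems(1) r by simp
    ultimately have "knuth (?u @ ?y # ?v @ [x]) (?y # ?u @ x # ?v)"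
      using xy by (intro knuth_row) auto
    then have "knuth (r @ [x]) (?y # insert_row r x)"
      using r by (metis append_Cons append_assoc insert_row_def)
    then have "knuth (concat (rev rs) @ (r @ [x]) @ []) (concat (rev rs) @ (?y # insert_row r x) @ [])"
      by (rule knuth_append)
    moreover have "knuth ([] @ (concat (rev rs) @ [?y]) @ insert_row r x)
        ([] @ concat (rev (row_insert rs ?y)) @ insert_row r x)"
      using Cons.prems y by (intro knuth_append Cons.IH) auto
    ultimately show ?thesis
      using True by (subst row_insert_eq) (auto intro: knuth.trans)
  next
    case False
    then have "insert_row r x = r @ [x]"
      using insert_pos_le[of r x] by (simp add: insert_row_def)
    then show ?thesis using False by (subst row_insert_eq) (simp add: knuth.refl)
  qed
qed

lemma rsk_P_snoc: "rsk_P (p @ [x]) = row_insert (rsk_P p) x"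
  by (simp add: rsk_P_def)

lemma mset_rsk_P: "mset (concat (rsk_P p)) = mset p"
  by (induction p rule: rev_induct) (simp_all add: rsk_P_snoc mset_row_insert, simp add: rsk_P_def)

lemma distinct_rsk_P: "distinct (concat (rsk_P p)) \<longleftrightarrow> distinct p"
  using mset_rsk_P[of p] mset_eq_imp_distinct_iff by blast

lemma set_rsk_P: "set (concat (rsk_P p)) = set p"
  using mset_rsk_P[of p] mset_eq_setD by blast

lemma rsk_P_tableau_knuth:
  assumes "distinct p"
  shows "tableau (rsk_P p) \<and> knuth p (concat (rev (rsk_P p)))"
  using assms
proof (induction p rule: rev_induct)
  case Nil
  then show ?case by (simp add: rsk_P_def knuth.refl)
next
  case (snoc x p)
  let ?T = "rsk_P p"
  have T: "tableau ?T" "distinct (concat ?T)" "x \<notin> set (concat ?T)"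
    using snoc by (auto simp: distinct_rsk_P set_rsk_P simp del: set_concat)
  have "knuth ([] @ p @ [x]) ([] @ concat (rev ?T) @ [x])"
    using snoc by (intro knuth_append) auto
  then show ?case
    using tableau_row_insert[OF T] knuth_row_insert[OF T]
    by (auto simp: rsk_P_snoc intro: knuth.trans)
qed

section \<open>Greene's theorem\<close>

lemma subseq_subset: "subseq xs ys \<Longrightarrow> set xs \<subseteq> set ys"
  by (induction rule: list_emb.induct) auto

lemma subseq_sorted_wrt: "subseq xs ys \<Longrightarrow> sorted_wrt P ys \<Longrightarrow> sorted_wrt P xs"
  by (induction rule: list_emb.induct) (auto dest!: subseq_subset)

lemma subseq_distinct: "subseq xs ys \<Longrightarrow> distinct ys \<Longrightarrow> distinct xs"
  by (metis in_set_subseqs subseqs_distinctD)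

lemma above_trans: "above r r' \<Longrightarrow> above r' r'' \<Longrightarrow> above r r''"
  unfolding above_def by (meson le_trans less_le_trans less_trans)

lemma tableau_sorted_above: "tableau T \<Longrightarrow> sorted_wrt above T"
proof (induction T)
  case (Cons r rs)
  then show ?case by (cases rs) (auto intro: above_trans)
qed simp

text \<open>A decreasing sequence meets each increasing row at most once.\<close>

lemma dec_bounded_concat:
  assumes "\<forall>r\<in>set R. sorted_wrt (<) r"
  shows "dec_bounded (length R) (concat R)"
  using assms
proof (induction R)
  case Nil
  then show ?case by (auto simp: dec_bounded_def dest: list_emb_length)
next
  case (Cons r R)
  show ?case unfolding dec_bounded_def
  proof (intro allI impI)
    fix ys assume ys: "subseq ys (concat (r # R))" "sorted_wrt (>) ys"
    then obtain a b where ab: "ys = a @ b" "subseq a r" "subseq b (concat R)"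
      by (auto simp: subseq_append_iff)
    then have "length b \<le> length R"
      using Cons ys(2) by (auto simp: dec_bounded_def sorted_wrt_append)
    moreover have "length a \<le> 1"
    proof (rule ccontr)
      assume "\<not> length a \<le> 1"
      then obtain x y zs where a: "a = x # y # zs"
        by (metis One_nat_def Suc_le_length_iff not_less_eq_eq)
      have "a ! 1 < a ! 0" using ys(2) unfolding ab(1) a by simp
      moreover have "sorted_wrt (<) a"
        using ab(2) Cons.prems by (auto intro: subseq_sorted_wrt)
      then have "a ! 0 < a ! 1" unfolding a by simp
      ultimately show False by simp
    qed
    ultimately show "length ys \<le> length (r # R)" using ab(1) by simp
  qed
qed

text \<open>Columns are read from bottom to top, so that they are decreasing subsequences of the
  reading word.\<close>

definition col :: "nat list list \<Rightarrow> nat \<Rightarrow> nat list" where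
  "col T c = map (\<lambda>r. r ! c) (filter (\<lambda>r. c < length r) (rev T))"

lemma subseq_col: "subseq (col T c) (concat (rev T))"
proof -
  have "subseq (map (\<lambda>r. r ! c) (filter (\<lambda>r. c < length r) R)) (concat R)" for R :: "nat list list"
  proof (induction R)
    case (Cons r R)
    show ?case
    proof (cases "c < length r")
      case True
      then have "subseq [r ! c] r" by (simp add: subseq_singleton_left)
      then have "subseq ([r ! c] @ map (\<lambda>r. r ! c) (filter (\<lambda>r. c < length r) R)) (r @ concat R)"
        using Cons by (rule list_emb_append_mono)
      then show ?thesis using True by simp
    qed (use Cons in \<open>simp add: subseq_drop_many\<close>)
  qed simp
  then show ?thesis unfolding col_def .
qed

lemma sorted_col:
  assumes "tableau T"
  shows "sorted_wrt (>) (col T c)"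
proof -
  have "sorted_wrt above (filter (\<lambda>r. c < length r) T)"
    using tableau_sorted_above[OF assms] by (rule sorted_wrt_filter)
  then have "sorted_wrt (\<lambda>r r'. r ! c < r' ! c) (filter (\<lambda>r. c < length r) T)"
    by (rule sorted_wrt_mono_rel[rotated]) (auto simp: above_def)
  then show ?thesis by (simp add: col_def sorted_wrt_map rev_filter[symmetric] sorted_wrt_rev)
qed

text \<open>With distinct letters, a subsequence is determined by its set of letters. This makes the
  part of a column that lies in a selection \<open>s\<close> a subsequence of
  \<open>s\<close>.\<close>

lemma filter_subseq_distinct:
  assumes "subseq s w" "distinct w"
  shows "filter (\<lambda>x. x \<in> set s) w = s"
proof -
  have s: "distinct s" "set s \<subseteq> set w"
    using subseq_distinct[OF assms] subseq_subset[OF assms(1)] by auto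
  have "subseq (filter (\<lambda>x. x \<in> set s) s) (filter (\<lambda>x. x \<in> set s) w)"
    using assms(1) by (rule subseq_filter)
  then have "subseq s (filter (\<lambda>x. x \<in> set s) w)" by simp
  moreover have "set (filter (\<lambda>x. x \<in> set s) w) = set s" using s by auto
  then have "length (filter (\<lambda>x. x \<in> set s) w) = length s"
    using s(1) assms(2) by (metis distinct_card distinct_filter)
  ultimately show ?thesis by (metis subseq_same_length)
qed

text \<open>Row lengths decrease, so the rows that reach column \<open>c\<close> form an initial
  segment; both sides count the cells of that column in the first \<open>j\<close> rows.\<close>

lemma min_length_filter_le:
  assumes "sorted_wrt (\<lambda>r r'. length r' \<le> length r) T"
  shows "min j (length (filter (\<lambda>r. c < length r) T))
    = length (filter (\<lambda>r. c < length r) (take j T))"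
  using assms
proof (induction T arbitrary: j)
  case (Cons r rs)
  show ?case
  proof (cases "c < length r")
    case True
    then show ?thesis using Cons by (cases j) auto
  next
    case False
    then have none: "\<forall>r'\<in>set rs. \<not> c < length r'" using Cons.prems by auto
    then have "\<forall>r'\<in>set (take j (r # rs)). \<not> c < length r'"
      using False by (auto dest!: in_set_takeD)
    then have "filter (\<lambda>r. c < length r) (take j (r # rs)) = []" by (simp add: filter_empty_conv)
    moreover have "filter (\<lambda>r. c < length r) (r # rs) = []"
      using none False by (simp add: filter_empty_conv)
    ultimately show ?thesis by simp
  qed
qed simp

lemma sum_length_filter:
  assumes "\<forall>r\<in>set R. length r \<le> M"
  shows "(\<Sum>c<M. length (filter (\<lambda>r. c < length r) R)) = sum_list (map length R)"
  using assms
proof (induction R)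
  case (Cons r R)
  have "(\<Sum>c<M. length (filter (\<lambda>r. c < length r) (r # R)))
    = (\<Sum>c<M. (if c < length r then 1 else 0) + length (filter (\<lambda>r. c < length r) R))"
    by (intro sum.cong) auto
  also have "\<dots> = (\<Sum>c<M. if c < length r then 1 else 0) + sum_list (map length R)"
    using Cons by (simp add: sum.distrib)
  also have "(\<Sum>c<M. if c < length r then 1 else 0) = card {c \<in> {..<M}. c < length r}"
    by (simp add: sum.If_cases Int_def)
  also have "{c \<in> {..<M}. c < length r} = {..<length r}" using Cons.prems by auto
  finally show ?case by simp
qed simp

text \<open>Upper bound: the columns cover all entries and are decreasing in the reading word, so an
  admissible selection meets each in at most \<open>j\<close> letters; summing over columns counts
  the cells of the first \<open>j\<close> rows. Lower bound: select exactly those rows.\<close>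

lemma greene_tableau:
  assumes T: "tableau T" and dist: "distinct (concat T)"
  shows "greene j (concat (rev T)) = sum_list (map length (take j T))"
proof (rule antisym)
  obtain s where s: "subseq s (concat (rev T))" "dec_bounded j s" "length s = greene j (concat (rev T))"
    by (rule greene_attained)
  define M where "M = length (concat T)"
  define f where "f = (\<lambda>c. filter (\<lambda>x. x \<in> set s) (col T c))"
  have set_rev: "set (concat (rev T)) = set (concat T)" by simp
  have "mset (concat (rev T)) = mset (concat T)"
    by (simp add: mset_concat rev_map[symmetric])
  then have dist': "distinct (concat (rev T))" using dist mset_eq_imp_distinct_iff by blast
  have M: "length r \<le> M" if "r \<in> set T" for r
    using that by (auto simp: M_def length_concat intro!: member_le_sum_list)
  have sorted_len: "sorted_wrt (\<lambda>r r'. length r' \<le> length r) T"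
    using tableau_sorted_above[OF T] by (rule sorted_wrt_mono_rel[rotated]) (simp add: above_def)
  have f: "length (f c) \<le> length (filter (\<lambda>r. c < length r) (take j T))" for c
  proof -
    have "subseq (f c) (filter (\<lambda>x. x \<in> set s) (concat (rev T)))"
      unfolding f_def by (intro subseq_filter subseq_col)
    then have "subseq (f c) s" using filter_subseq_distinct[OF s(1) dist'] by simp
    moreover have "sorted_wrt (>) (f c)" unfolding f_def by (intro sorted_wrt_filter sorted_col T)
    ultimately have "length (f c) \<le> j" using s(2) by (simp add: dec_bounded_def)
    moreover have "length (f c) \<le> length (col T c)" by (simp add: f_def)
    then have "length (f c) \<le> length (filter (\<lambda>r. c < length r) T)"
      by (simp add: col_def rev_filter[symmetric])
    ultimately show ?thesis by (simp add: min_length_filter_le[OF sorted_len, symmetric])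
  qed
  have "set s \<subseteq> (\<Union>c<M. set (f c))"
  proof
    fix x assume x: "x \<in> set s"
    then have "x \<in> set (concat T)" using subseq_subset[OF s(1)] set_rev by auto
    then obtain r where r: "r \<in> set T" "x \<in> set r" by auto
    then obtain c where c: "c < length r" "x = r ! c" by (auto simp: in_set_conv_nth)
    then have "x \<in> set (f c)" using r x by (auto simp: f_def col_def)
    moreover have "c < M" using c M[OF r(1)] by simp
    ultimately show "x \<in> (\<Union>c<M. set (f c))" by blast
  qed
  then have "card (set s) \<le> card (\<Union>c<M. set (f c))" by (intro card_mono) auto
  also have "\<dots> \<le> (\<Sum>c<M. card (set (f c)))" by (intro card_UN_le) simp
  also have "\<dots> \<le> (\<Sum>c<M. length (filter (\<lambda>r. c < length r) (take j T)))"
    using f by (intro sum_mono) (meson card_length le_trans)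
  also have "\<dots> = sum_list (map length (take j T))"
    using M by (intro sum_length_filter) (auto dest: in_set_takeD)
  also have "card (set s) = length s"
    using subseq_distinct[OF s(1) dist'] by (simp add: distinct_card)
  finally show "greene j (concat (rev T)) \<le> sum_list (map length (take j T))" using s(3) by simp
next
  have rows: "\<forall>r\<in>set T. sorted_wrt (<) r" using T by (induction T) auto
  let ?s = "concat (rev (take j T))"
  have "concat (rev T) = concat (rev (drop j T)) @ ?s"
    by (metis append_take_drop_id concat_append rev_append)
  then have "subseq ?s (concat (rev T))" by (simp add: subseq_drop_many)
  moreover have "dec_bounded (length (rev (take j T))) ?s"
    using rows by (intro dec_bounded_concat) (auto dest: in_set_takeD)
  then have "dec_bounded j ?s" by (auto simp: dec_bounded_def)
  ultimately have "length ?s \<le> greene j (concat (rev T))" by (rule greene_upper)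
  then show "sum_list (map length (take j T)) \<le> greene j (concat (rev T))"
    by (simp add: length_concat rev_map[symmetric])
qed

lemma sum_part_entry: "(\<Sum>i<j. part_entry (map length T) i) = sum_list (map length (take j T))"
proof (induction T arbitrary: j)
  case Nil
  then show ?case by (simp add: part_entry_def)
next
  case (Cons r rs)
  have "part_entry (map length (r # rs)) (Suc i) = part_entry (map length rs) i" for i
    by (simp add: part_entry_def)
  moreover have "part_entry (map length (r # rs)) 0 = length r"
    by (simp add: part_entry_def)
  ultimately have "(\<Sum>i<Suc k. part_entry (map length (r # rs)) i)
    = length r + (\<Sum>i<k. part_entry (map length rs) i)" for k
    unfolding sum.lessThan_Suc_shift by simp
  then show ?case using Cons by (cases j) (simp_all del: sum.lessThan_Suc)
qed

lemma greene_rsk: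
  assumes "distinct p"
  shows "(\<Sum>i<j. part_entry (rsk_shape p) i) = greene j p"
  using rsk_P_tableau_knuth[OF assms] greene_knuth greene_tableau[of "rsk_P p" j] assms
  by (metis distinct_rsk_P rsk_shape_def sum_part_entry)

lemma antimono_part_entry:
  assumes "tableau T"
  shows "antimono (part_entry (map length T))"
proof (rule antimonoI)
  fix i k :: nat assume "i \<le> k"
  show "part_entry (map length T) k \<le> part_entry (map length T) i"
  proof (cases "k < length T \<and> i \<noteq> k")
    case True
    then have "above (T ! i) (T ! k)"
      using tableau_sorted_above[OF assms] \<open>i \<le> k\<close> by (simp add: sorted_wrt_iff_nth_less)
    then show ?thesis using True \<open>i \<le> k\<close> by (simp add: part_entry_def above_def)
  qed (use \<open>i \<le> k\<close> in \<open>auto simp: part_entry_def\<close>)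
qed

section \<open>Adjacent transpositions\<close>

lemma adj_swap_transpose: "adj_swap k p = map (transpose k (Suc k)) p"
  by (simp add: adj_swap_def transpose_def)

lemma adj_swap_adj_swap [simp]: "adj_swap k (adj_swap k p) = p"
  by (simp add: adj_swap_transpose)

lemma distinct_adj_swap [simp]: "distinct (adj_swap k p) \<longleftrightarrow> distinct p"
  unfolding adj_swap_transpose distinct_map
  using inj_on_inverseI[of "set p" "transpose k (Suc k)" "transpose k (Suc k)"] by simp

text \<open>Deleting the letter \<open>k\<close> makes the relabelling strictly monotone on what is left.\<close>

lemma greene_le_adj_swap:
  assumes "distinct w"
  shows "greene j w \<le> greene j (adj_swap k w) + 1"
proof (rule greene_leI)
  fix s assume s: "subseq s w" "dec_bounded j s"
  define u where "u = filter (\<lambda>x. x \<noteq> k) s"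
  let ?\<sigma> = "transpose k (Suc k)"
  have u: "subseq u s" "k \<notin> set u" by (auto simp: u_def)
  have "dec_bounded j (map ?\<sigma> u)"
    unfolding dec_bounded_def
  proof (intro allI impI)
    fix ys assume ys: "subseq ys (map ?\<sigma> u)" "sorted_wrt (>) ys"
    define zs where "zs = map ?\<sigma> ys"
    have "subseq zs (map ?\<sigma> (map ?\<sigma> u))" unfolding zs_def using ys(1) by (rule subseq_map)
    then have zs: "subseq zs u" by simp
    have ys_eq: "ys = map ?\<sigma> zs" by (simp add: zs_def)
    have "k \<notin> set zs" using u(2) subseq_subset[OF zs] by auto
    have "sorted_wrt (>) zs"
    proof (rule sorted_wrt_mono_rel)
      show "sorted_wrt (\<lambda>x y. ?\<sigma> x > ?\<sigma> y) zs"
        using ys(2) unfolding ys_eq sorted_wrt_map .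
      fix x y assume "x \<in> set zs" "y \<in> set zs" "?\<sigma> x > ?\<sigma> y"
      moreover from this have "x \<noteq> k" "y \<noteq> k" using \<open>k \<notin> set zs\<close> by auto
      ultimately show "x > y" by (auto simp: transpose_def split: if_splits)
    qed
    moreover have "subseq zs s" using zs u(1) by (rule subseq_order.trans)
    ultimately show "length ys \<le> j" using s(2) by (simp add: dec_bounded_def ys_eq)
  qed
  moreover have "subseq (map ?\<sigma> u) (adj_swap k w)"
    unfolding adj_swap_transpose using u(1) s(1) by (intro subseq_map) (rule subseq_order.trans)
  moreover have "length s \<le> length (map ?\<sigma> u) + 1"
  proof -
    have "distinct s" using s(1) assms by (rule subseq_distinct)
    then have "length (filter (\<lambda>x. x = k) s) \<le> 1"
      using card_mono[of "{k}" "{x. x = k} \<inter> set s"] by (simp add: distinct_length_filter)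
    then show ?thesis using sum_length_filter_compl[of "\<lambda>x. x = k" s] by (simp add: u_def)
  qed
  ultimately show "\<exists>s'. subseq s' (adj_swap k w) \<and> dec_bounded j s' \<and> length s \<le> length s' + 1"
    by blast
qed

lemma greene_adj_swap_path:
  assumes "distinct p"
  shows "\<bar>real (greene j p) - real (greene j (fold adj_swap ks p))\<bar> \<le> real (length ks)"
  using assms
proof (induction ks arbitrary: p)
  case (Cons k ks)
  have "greene j p \<le> greene j (adj_swap k p) + 1" "greene j (adj_swap k p) \<le> greene j p + 1"
    using greene_le_adj_swap[of p j k] greene_le_adj_swap[of "adj_swap k p" j k] Cons.prems by auto
  then have "\<bar>real (greene j p) - real (greene j (adj_swap k p))\<bar> \<le> 1" by linarith
  then show ?case using Cons.IH[of "adj_swap k p"] Cons.prems by simp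
qed simp

section \<open>Connectedness of permutations under adjacent transpositions\<close>

text \<open>\<open>perm_dist\<close> is a \<open>LEAST\<close>, so it yields a path of that length
  only once some path is known to exist.\<close>

definition swap_path :: "nat \<Rightarrow> nat list \<Rightarrow> nat list \<Rightarrow> bool" where
  "swap_path n p q \<longleftrightarrow> (\<exists>ks. (\<forall>k\<in>set ks. 1 \<le> k \<and> k \<le> n - 1) \<and> fold adj_swap ks p = q)"

lemma swap_path_trans: "swap_path n p q \<Longrightarrow> swap_path n q r \<Longrightarrow> swap_path n p r"
  unfolding swap_path_def
proof (elim exE conjE)
  fix ks ks'
  assume "\<forall>k\<in>set ks. 1 \<le> k \<and> k \<le> n - 1" "fold adj_swap ks p = q"
    "\<forall>k\<in>set ks'. 1 \<le> k \<and> k \<le> n - 1" "fold adj_swap ks' q = r"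
  then show "\<exists>ks. (\<forall>k\<in>set ks. 1 \<le> k \<and> k \<le> n - 1) \<and> fold adj_swap ks p = r"
    by (intro exI[of _ "ks @ ks'"]) auto
qed

lemma swap_path_adj_swap: "1 \<le> k \<Longrightarrow> k < n \<Longrightarrow> swap_path n p (adj_swap k p)"
  unfolding swap_path_def by (intro exI[of _ "[k]"]) auto

lemma swap_path_transpose:
  assumes "1 \<le> a" "a < b" "b \<le> n"
  shows "swap_path n p (map (transpose a b) p)"
  using assms(2,3)
proof (induction b arbitrary: p)
  case (Suc b)
  show ?case
  proof (cases "a = b")
    case True
    then show ?thesis
      using swap_path_adj_swap[of a n p] Suc.prems assms(1) by (simp add: adj_swap_transpose)
  next
    case False
    have "transpose a (Suc b) = transpose b (Suc b) \<circ> transpose a b \<circ> transpose b (Suc b)"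
      using False Suc.prems by (auto simp: transpose_def fun_eq_iff)
    then have "map (transpose a (Suc b)) p = adj_swap b (map (transpose a b) (adj_swap b p))"
      by (simp add: adj_swap_transpose)
    moreover have "swap_path n p (adj_swap b p)"
      "swap_path n (adj_swap b p) (map (transpose a b) (adj_swap b p))"
      "swap_path n (map (transpose a b) (adj_swap b p)) (adj_swap b (map (transpose a b) (adj_swap b p)))"
      using False Suc assms(1) by (auto intro!: swap_path_adj_swap)
    ultimately show ?thesis by (metis swap_path_trans)
  qed
qed simp

lemma swap_path_permutes:
  assumes "\<sigma> permutes {1..n}"
  shows "swap_path n p (map \<sigma> p)"
  using assms finite_atLeastAtMost
proof (induction rule: permutes_induct)
  case id
  then show ?case unfolding swap_path_def by (intro exI[of _ "[]"]) simp
next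
  case (swap a b \<sigma>)
  have "swap_path n (map \<sigma> p) (map (transpose a b) (map \<sigma> p))"
  proof (cases "a < b")
    case True
    then show ?thesis using swap by (intro swap_path_transpose) auto
  next
    case False
    then have "swap_path n (map \<sigma> p) (map (transpose b a) (map \<sigma> p))"
      using swap by (intro swap_path_transpose) auto
    then show ?thesis by (simp add: transpose_commute)
  qed
  then show ?case using swap swap_path_trans by (metis map_map)
qed

lemma swap_path_is_perm:
  assumes p: "is_perm n p" and q: "is_perm n q"
  shows "swap_path n p q"
proof -
  \<comment> \<open>The left multiplier taking \<open>p\<close> to \<open>q\<close>, that is
    \<open>q\<close> composed with the inverse of \<open>p\<close>, made the identity outside
    \<open>{1..n}\<close> as \<open>permutes\<close> demands.\<close>
  define \<sigma> where "\<sigma> = (\<lambda>x. if x \<in> {1..n} then the (map_of (zip p q) x) else x)"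
  have len: "length p = length q" using p q by (metis distinct_card is_perm_def)
  have map: "map \<sigma> p = q"
  proof (rule nth_equalityI)
    fix i assume "i < length (map \<sigma> p)"
    then have i: "i < length p" by simp
    then have "p ! i \<in> {1..n}" using p by (metis is_perm_def nth_mem)
    then show "map \<sigma> p ! i = q ! i"
      using i p len map_of_zip_nth[of p q i] by (simp add: \<sigma>_def is_perm_def)
  qed (simp add: len)
  have "bij_betw \<sigma> {1..n} {1..n}"
    unfolding bij_betw_def using p q map by (metis distinct_map is_perm_def set_map)
  then have "\<sigma> permutes {1..n}" by (rule bij_imp_permutes) (auto simp: \<sigma>_def)
  then show ?thesis using swap_path_permutes[of \<sigma> n p] map by simp
qed

lemma perm_dist_path:
  assumes "is_perm n p" "is_perm n q"
  obtains ks where "length ks = perm_dist n p q" "fold adj_swap ks p = q"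
proof -
  obtain ks where "\<forall>k\<in>set ks. 1 \<le> k \<and> k \<le> n - 1" "fold adj_swap ks p = q"
    using swap_path_is_perm[OF assms] unfolding swap_path_def by blast
  then have "\<exists>m ks. length ks = m \<and> (\<forall>k\<in>set ks. 1 \<le> k \<and> k \<le> n - 1) \<and> fold adj_swap ks p = q"
    by blast
  from LeastI_ex[OF this] show ?thesis using that unfolding perm_dist_def by blast
qed

theorem theorem6:
  shows "\<exists>C::real. C > 0 \<and>
    (\<forall>n t p q. n \<ge> 1 \<longrightarrow> t \<ge> 2 \<longrightarrow> is_perm n p \<longrightarrow> is_perm n q \<longrightarrow>
       perm_dist n p q = t \<longrightarrow>
       part_dist n (rsk_shape p) (rsk_shape q) \<le> C * sqrt (real n * real t * ln (real t)))"
proof (intro exI[of _ "33/2"] conjI allI impI)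
  fix n t p q
  assume n: "1 \<le> n" and t: "2 \<le> t" and p: "is_perm n p" and q: "is_perm n q"
    and pq: "perm_dist n p q = t"
  have dist: "distinct p" "distinct q" using p q by (simp_all add: is_perm_def)
  have anti: "antimono (part_entry (rsk_shape w))" if "distinct w" for w
    unfolding rsk_shape_def using rsk_P_tableau_knuth[OF that] by (simp add: antimono_part_entry)
  \<comment> \<open>Stated for every \<open>N\<close>, because the dyadic blocks may run past row
    \<open>n\<close>.\<close>
  have size: "(\<Sum>i<N. part_entry (rsk_shape w) i) \<le> n" if w: "is_perm n w" for w N
  proof -
    obtain s where "subseq s w" "length s = greene N w" by (rule greene_attained)
    moreover have "length w = n"
      using w distinct_card[of w] by (simp add: is_perm_def)
    ultimately show ?thesis using w greene_rsk[of w N] list_emb_length[of _ s w] by (simp add: is_perm_def)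
  qed
  obtain ks where ks: "length ks = t" "fold adj_swap ks p = q"
    using perm_dist_path[OF p q] pq by metis
  have D: "\<bar>(\<Sum>i<j. real (part_entry (rsk_shape p) i)) - (\<Sum>i<j. real (part_entry (rsk_shape q) i))\<bar> \<le> real t" for j
    using greene_adj_swap_path[OF dist(1), of j ks] ks greene_rsk[of _ j] dist
    unfolding of_nat_sum[symmetric] by simp
  have "(\<Sum>i<n. \<bar>real (part_entry (rsk_shape p) i) - real (part_entry (rsk_shape q) i)\<bar>)
    \<le> 33 * sqrt (real n * real t * ln (real t))"
    by (rule partition_distance_bound[OF anti anti size size D n t]) (use dist p q in auto)
  \<comment> \<open>The factor 1/2 in \<open>part_dist\<close> halves the constant 33.\<close>
  then show "part_dist n (rsk_shape p) (rsk_shape q) \<le> 33/2 * sqrt (real n * real t * ln (real t))"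
    unfolding part_dist_def by simp
qed simp

end
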